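(* Let $\mathbf A$ be a finite hoop and let $F$ be a filter of $\mathbf A$, with least element $l$; let $\mathbf F$ denote the subhoop of $\mathbf A$ with universe $F$. For $X\in\mathbf A/F$ let $t_X$ denote the greatest element of the class $X$. Then the map $\psi\colon\mathbf A/F\to\mathbf F$, $\psi(X)=t_X\vee l$, is a product morphism, and $\mathbf A\cong\mathbf F\ltimes_\psi(\mathbf A/F)$.
   Context: A hoop is an algebra $\mathbf A=(A;\cdot,\rightarrow,1)$ of type $\langle 2,2,0\rangle$ such that $(A;\cdot,1)$ is a commutative monoid and the identities $x\rightarrow x=1$, $(x\cdot y)\rightarrow z=x\rightarrow(y\rightarrow z)$ and $x\cdot(x\rightarrow y)=y\cdot(y\rightarrow x)$ hold. The order is $x\leq y$ iff $x\rightarrow y=1$; infima exist ($x\wedge y=x\cdot(x\rightarrow y)$), and in a finite hoop suprema $\vee$ exist. A filter of $\mathbf A$ is a nonempty $F\subseteq A$ that is upward closed and closed under $\cdot$; it is a subuniverse of $\mathbf A$. It induces the congruence $\theta_F=\{(x,y)\mid (x\rightarrow y)\cdot(y\rightarrow x)\in F\}$, and $\mathbf A/F$ denotes the quotient hoop $\mathbf A/\theta_F$. A map $f\colon B\to A$ between hoops is a product morphism if $f(1)=1$ and $f(x)\cdot f(y)=f(x\cdot y)=f(x)\wedge f(y)=f(x\wedge y)$ for all $x,y\in B$. For such $f$, the $f$-product $\mathbf A\ltimes_f\mathbf B$ is the hoop with universe $\{(a,x)\in A\times B\mid a\leq f(x)\}$, constant $(1,1)$ and operations $(a,x)\cdot(b,y)=(a\cdot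 b,\,x\cdot y)$ and $(a,x)\rightarrow(b,y)=(f(x\rightarrow y)\wedge(a\rightarrow b),\,x\rightarrow y)$. *)

theory Defs
  imports "HOL-Algebra.Group" "HOL-Algebra.Lattice"
begin

record 'a hoop = "'a monoid" +
  imp :: "['a, 'a] \<Rightarrow> 'a" (infixr \<open>\<leadsto>\<index>\<close> 60)

locale hoop = comm_monoid H for H (structure) +
  assumes imp_closed [intro, simp]:
      "\<lbrakk>x \<in> carrier H; y \<in> carrier H\<rbrakk> \<Longrightarrow> x \<leadsto> y \<in> carrier H"
    and imp_self [simp]: "x \<in> carrier H \<Longrightarrow> x \<leadsto> x = \<one>"
    and mult_imp: "\<lbrakk>x \<in> carrier H; y \<in> carrier H; z \<in> carrier H\<rbrakk>
      \<Longrightarrow> (x \<otimes> y) \<leadsto> z = x \<leadsto> (y \<leadsto> z)"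
    and mult_imp_swap: "\<lbrakk>x \<in> carrier H; y \<in> carrier H\<rbrakk>
      \<Longrightarrow> x \<otimes> (x \<leadsto> y) = y \<otimes> (y \<leadsto> x)"

definition hoop_order :: "('a, 'm) hoop_scheme \<Rightarrow> 'a gorder" where
  "hoop_order H = \<lparr>carrier = carrier H, eq = (=), le = (\<lambda>x y. x \<leadsto>\<^bsub>H\<^esub> y = \<one>\<^bsub>H\<^esub>)\<rparr>"

text \<open>The infimum; see \<open>hoop.inf_greatest\<close> below. Suprema are taken
  in the order, as \<open>x \<squnion>\<^bsub>hoop_order H\<^esub> y\<close>.\<close>

definition hoop_inf :: "('a, 'm) hoop_scheme \<Rightarrow> 'a \<Rightarrow> 'a \<Rightarrow> 'a" where
  "hoop_inf H x y = x \<otimes>\<^bsub>H\<^esub> (x \<leadsto>\<^bsub>H\<^esub> y)"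

definition hoop_filter :: "('a, 'm) hoop_scheme \<Rightarrow> 'a set \<Rightarrow> bool" where
  "hoop_filter H F \<longleftrightarrow> F \<subseteq> carrier H \<and> F \<noteq> {} \<and>
    (\<forall>x\<in>F. \<forall>y\<in>carrier H. x \<sqsubseteq>\<^bsub>hoop_order H\<^esub> y \<longrightarrow> y \<in> F) \<and>
    (\<forall>x\<in>F. \<forall>y\<in>F. x \<otimes>\<^bsub>H\<^esub> y \<in> F)"

definition filter_cong :: "('a, 'm) hoop_scheme \<Rightarrow> 'a set \<Rightarrow> 'a rel" where
  "filter_cong H F = {(x, y). x \<in> carrier H \<and> y \<in> carrier H \<and>
    (x \<leadsto>\<^bsub>H\<^esub> y) \<otimes>\<^bsub>H\<^esub> (y \<leadsto>\<^bsub>H\<^esub> x) \<in> F}"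

text \<open>For a filter the unions below range over equal classes, see
  \<open>hoop.quotient_mult\<close> and \<open>hoop.quotient_imp\<close>.\<close>

definition hoop_quotient :: "('a, 'm) hoop_scheme \<Rightarrow> 'a set \<Rightarrow> 'a set hoop" where
  "hoop_quotient H F =
    \<lparr>carrier = carrier H // filter_cong H F,
     mult = (\<lambda>X Y. \<Union>x\<in>X. \<Union>y\<in>Y. filter_cong H F `` {x \<otimes>\<^bsub>H\<^esub> y}),
     one = filter_cong H F `` {\<one>\<^bsub>H\<^esub>},
     imp = (\<lambda>X Y. \<Union>x\<in>X. \<Union>y\<in>Y. filter_cong H F `` {x \<leadsto>\<^bsub>H\<^esub> y})\<rparr>"

definition subhoop :: "('a, 'm) hoop_scheme \<Rightarrow> 'a set \<Rightarrow> ('a, 'm) hoop_scheme" where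
  "subhoop H S = H\<lparr>carrier := S\<rparr>"

definition product_morphism ::
    "('b, 'n) hoop_scheme \<Rightarrow> ('a, 'm) hoop_scheme \<Rightarrow> ('b \<Rightarrow> 'a) \<Rightarrow> bool" where
  "product_morphism B A f \<longleftrightarrow> hoop B \<and> hoop A \<and> f \<in> carrier B \<rightarrow> carrier A \<and>
    f \<one>\<^bsub>B\<^esub> = \<one>\<^bsub>A\<^esub> \<and>
    (\<forall>x\<in>carrier B. \<forall>y\<in>carrier B.
      f x \<otimes>\<^bsub>A\<^esub> f y = f (x \<otimes>\<^bsub>B\<^esub> y) \<and>
      f (x \<otimes>\<^bsub>B\<^esub> y) = hoop_inf A (f x) (f y) \<and>
      hoop_inf A (f x) (f y) = f (hoop_inf B x y))"

definition f_product ::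
    "('a, 'm) hoop_scheme \<Rightarrow> ('b \<Rightarrow> 'a) \<Rightarrow> ('b, 'n) hoop_scheme \<Rightarrow> ('a \<times> 'b) hoop" where
  "f_product A f B =
    \<lparr>carrier = {(a, x). a \<in> carrier A \<and> x \<in> carrier B \<and> a \<sqsubseteq>\<^bsub>hoop_order A\<^esub> f x},
     mult = (\<lambda>(a, x) (b, y). (a \<otimes>\<^bsub>A\<^esub> b, x \<otimes>\<^bsub>B\<^esub> y)),
     one = (\<one>\<^bsub>A\<^esub>, \<one>\<^bsub>B\<^esub>),
     imp = (\<lambda>(a, x) (b, y). (hoop_inf A (f (x \<leadsto>\<^bsub>B\<^esub> y)) (a \<leadsto>\<^bsub>A\<^esub> b), x \<leadsto>\<^bsub>B\<^esub> y))\<rparr>"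

definition hoop_iso :: "('a, 'm) hoop_scheme \<Rightarrow> ('b, 'n) hoop_scheme \<Rightarrow> ('a \<Rightarrow> 'b) set" where
  "hoop_iso A B = {h \<in> iso A B. h \<one>\<^bsub>A\<^esub> = \<one>\<^bsub>B\<^esub> \<and>
    (\<forall>x\<in>carrier A. \<forall>y\<in>carrier A. h (x \<leadsto>\<^bsub>A\<^esub> y) = h x \<leadsto>\<^bsub>B\<^esub> h y)}"

definition hoop_isomorphic :: "('a, 'm) hoop_scheme \<Rightarrow> ('b, 'n) hoop_scheme \<Rightarrow> bool" where
  "hoop_isomorphic A B \<longleftrightarrow> hoop_iso A B \<noteq> {}"

definition class_top :: "('a, 'm) hoop_scheme \<Rightarrow> 'a set \<Rightarrow> 'a" where
  "class_top H X = (THE t. greatest (hoop_order H) t X)"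

definition class_top_join ::
    "('a, 'm) hoop_scheme \<Rightarrow> 'a \<Rightarrow> 'a set \<Rightarrow> 'a" where
  "class_top_join H l X = class_top H X \<squnion>\<^bsub>hoop_order H\<^esub> l"


lemma hoop_order_simps [simp]:
  "carrier (hoop_order H) = carrier H"
  "x .=\<^bsub>hoop_order H\<^esub> y \<longleftrightarrow> x = y"
  "x \<sqsubseteq>\<^bsub>hoop_order H\<^esub> y \<longleftrightarrow> x \<leadsto>\<^bsub>H\<^esub> y = \<one>\<^bsub>H\<^esub>"
  by (simp_all add: hoop_order_def)

context hoop
begin

lemma le_antisymm:
  assumes "x \<in> carrier H" "y \<in> carrier H" "x \<leadsto> y = \<one>" "y \<leadsto> x = \<one>"
  shows "x = y"
  using mult_imp_swap[of x y] assms by simp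

lemma one_imp [simp]:
  assumes "x \<in> carrier H" shows "\<one> \<leadsto> x = x"
proof (rule le_antisymm)
  show "(\<one> \<leadsto> x) \<leadsto> x = \<one>"
    using mult_imp[of "\<one> \<leadsto> x" \<one> x] assms by simp
  show "x \<leadsto> (\<one> \<leadsto> x) = \<one>"
    using mult_imp[of x \<one> x] assms by simp
qed (use assms in auto)

lemma imp_one [simp]:
  assumes "x \<in> carrier H" shows "x \<leadsto> \<one> = \<one>"
proof -
  have "x \<otimes> (x \<leadsto> \<one>) = x" using mult_imp_swap[of x \<one>] assms by simp
  then have "x \<leadsto> \<one> = ((x \<leadsto> \<one>) \<otimes> x) \<leadsto> \<one>" using assms by (simp add: m_comm)
  also have "\<dots> = \<one>" using assms by (simp only: mult_imp imp_closed one_closed imp_self)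
  finally show ?thesis .
qed

lemma le_transitive:
  assumes "x \<in> carrier H" "y \<in> carrier H" "z \<in> carrier H" "x \<leadsto> y = \<one>" "y \<leadsto> z = \<one>"
  shows "x \<leadsto> z = \<one>"
proof -
  have "x = (y \<leadsto> x) \<otimes> y" using mult_imp_swap[of x y] assms by (simp add: m_comm)
  then have "x \<leadsto> z = (y \<leadsto> x) \<leadsto> (y \<leadsto> z)" using assms mult_imp by (metis imp_closed)
  then show ?thesis using assms by simp
qed

lemma mult_mono:
  assumes "x \<in> carrier H" "y \<in> carrier H" "z \<in> carrier H" "x \<leadsto> y = \<one>"
  shows "(x \<otimes> z) \<leadsto> (y \<otimes> z) = \<one>"
proof -
  have "y \<leadsto> (z \<leadsto> (y \<otimes> z)) = \<one>" using assms mult_imp[of y z "y \<otimes> z"] by simp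
  then have "x \<leadsto> (z \<leadsto> (y \<otimes> z)) = \<one>" using le_transitive[of x y] assms by simp
  then show ?thesis using assms by (simp add: mult_imp)
qed

lemma mult_le:
  assumes "x \<in> carrier H" "y \<in> carrier H"
  shows "(x \<otimes> y) \<leadsto> y = \<one>" "(x \<otimes> y) \<leadsto> x = \<one>"
proof -
  show "(x \<otimes> y) \<leadsto> y = \<one>" using assms by (simp add: mult_imp)
  have "(y \<otimes> x) \<leadsto> x = \<one>" using assms by (simp add: mult_imp)
  then show "(x \<otimes> y) \<leadsto> x = \<one>" using assms by (simp add: m_comm)
qed

lemma partial_order_hoop_order: "partial_order (hoop_order H)"
  by unfold_locales (auto intro: le_antisymm le_transitive simp: fun_eq_iff)

lemma imp_mult_le:
  assumes "x \<in> carrier H" "y \<in> carrier H"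
  shows "(x \<otimes> (x \<leadsto> y)) \<leadsto> y = \<one>"
  using assms mult_imp_swap[of x y] mult_le(2)[of y "y \<leadsto> x"] by simp

lemma inf_greatest:
  assumes "x \<in> carrier H" "y \<in> carrier H"
  shows "greatest (hoop_order H) (hoop_inf H x y) (Lower (hoop_order H) {x, y})"
proof -
  have "z \<leadsto> hoop_inf H x y = \<one>"
    if z: "z \<in> carrier H" "z \<leadsto> x = \<one>" "z \<leadsto> y = \<one>" for z
  proof -
    have zx: "z = (x \<leadsto> z) \<otimes> x" using mult_imp_swap[of x z] z assms by (simp add: m_comm)
    have "(x \<leadsto> z) \<leadsto> (x \<leadsto> y) = \<one>"
      using mult_imp[of "x \<leadsto> z" x y] zx z assms by simp
    then have "((x \<leadsto> z) \<otimes> x) \<leadsto> ((x \<leadsto> y) \<otimes> x) = \<one>"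
      using mult_mono z assms by simp
    then show ?thesis using zx assms by (simp add: hoop_inf_def m_comm)
  qed
  then show ?thesis
    using assms mult_le(2)[of x "x \<leadsto> y"] imp_mult_le[of x y]
    by (auto simp: greatest_def Lower_def hoop_inf_def)
qed

lemma hoop_inf_le:
  assumes "x \<in> carrier H" "y \<in> carrier H"
  shows "hoop_inf H x y \<in> carrier H" "hoop_inf H x y \<leadsto> x = \<one>" "hoop_inf H x y \<leadsto> y = \<one>"
  using inf_greatest[OF assms] assms by (auto simp: greatest_def Lower_def)

lemma le_hoop_inf:
  assumes "x \<in> carrier H" "y \<in> carrier H" "z \<in> carrier H" "z \<leadsto> x = \<one>" "z \<leadsto> y = \<one>"
  shows "z \<leadsto> hoop_inf H x y = \<one>"
  using inf_greatest[OF assms(1,2)] assms by (auto simp: greatest_def Lower_def)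

text \<open>In a finite hoop the suprema used in \<^const>\<open>class_top_join\<close> exist.\<close>

lemma join_least:
  assumes fin: "finite (carrier H)" and xy: "x \<in> carrier H" "y \<in> carrier H"
  shows "least (hoop_order H) (x \<squnion>\<^bsub>hoop_order H\<^esub> y) (Upper (hoop_order H) {x, y})"
proof -
  let ?U = "Upper (hoop_order H) {x, y}"
  have low: "\<exists>m\<in>?U. \<forall>u\<in>S. m \<leadsto> u = \<one>" if "finite S" "S \<subseteq> ?U" for S
    using that
  proof (induction S)
    case empty
    have "\<one> \<in> ?U" using xy by (auto simp: Upper_def)
    then show ?case by blast
  next
    case (insert s S)
    then obtain m where m: "m \<in> ?U" "\<forall>u\<in>S. m \<leadsto> u = \<one>" by auto
    let ?n = "hoop_inf H s m"
    have c: "s \<in> carrier H" "m \<in> carrier H" using insert.prems m by (auto simp: Upper_def)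
    have "?n \<in> ?U"
      using c m insert.prems xy by (auto simp: Upper_def hoop_inf_le intro!: le_hoop_inf)
    moreover have "\<forall>u\<in>insert s S. ?n \<leadsto> u = \<one>"
    proof
      fix u assume u: "u \<in> insert s S"
      then have uc: "u \<in> carrier H" using insert.prems by (auto simp: Upper_def)
      show "?n \<leadsto> u = \<one>"
      proof (cases "u = s")
        case False
        then show ?thesis
          using u m c uc le_transitive[of ?n m u] by (auto simp: hoop_inf_le)
      qed (use c in \<open>auto simp: hoop_inf_le\<close>)
    qed
    ultimately show ?case by blast
  qed
  have "finite ?U" using fin by (auto simp: Upper_def)
  with low[of ?U] obtain m where "least (hoop_order H) m ?U"
    by (auto simp: least_def Upper_def)
  then show ?thesis unfolding join_def sup_def by (rule someI)
qed

end

locale hoop_with_filter = hoop +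
  fixes F
  assumes filter: "hoop_filter H F"
begin

lemma F_sub: "x \<in> F \<Longrightarrow> x \<in> carrier H"
  and F_up: "\<lbrakk>x \<in> F; y \<in> carrier H; x \<leadsto> y = \<one>\<rbrakk> \<Longrightarrow> y \<in> F"
  and F_mult: "\<lbrakk>x \<in> F; y \<in> F\<rbrakk> \<Longrightarrow> x \<otimes> y \<in> F"
  using filter by (auto simp: hoop_filter_def)

lemma F_one: "\<one> \<in> F"
  using filter F_up by (auto simp: hoop_filter_def)

lemma cong_iff:
  "(x, y) \<in> filter_cong H F \<longleftrightarrow>
    x \<in> carrier H \<and> y \<in> carrier H \<and> x \<leadsto> y \<in> F \<and> y \<leadsto> x \<in> F"
proof -
  have "x \<leadsto> y \<in> F \<and> y \<leadsto> x \<in> F"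
    if c: "x \<in> carrier H" "y \<in> carrier H" and m: "(x \<leadsto> y) \<otimes> (y \<leadsto> x) \<in> F"
    using F_up[OF m] mult_le[of "x \<leadsto> y" "y \<leadsto> x"] c by simp
  then show ?thesis unfolding filter_cong_def by (blast intro: F_mult)
qed

lemma imp_trans_le:
  assumes x: "x \<in> carrier H" and y: "y \<in> carrier H" and z: "z \<in> carrier H"
  shows "((x \<leadsto> y) \<otimes> (y \<leadsto> z)) \<leadsto> (x \<leadsto> z) = \<one>"
proof -
  define a b where "a = x \<leadsto> y" and "b = y \<leadsto> z"
  have ab: "a \<in> carrier H" "b \<in> carrier H" using assms by (simp_all add: a_def b_def)
  have "(x \<otimes> a) \<leadsto> y = \<one>" "(y \<otimes> b) \<leadsto> z = \<one>"
    using assms by (simp_all only: a_def b_def imp_mult_le)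
  then have "((x \<otimes> a) \<otimes> b) \<leadsto> z = \<one>"
    using mult_mono[of "x \<otimes> a" y b] le_transitive[of "(x \<otimes> a) \<otimes> b" "y \<otimes> b" z] ab assms
    by blast
  moreover have "(x \<otimes> a) \<otimes> b = (a \<otimes> b) \<otimes> x"
    using m_assoc[of x a b] m_comm[of x "a \<otimes> b"] ab x by (simp only: m_closed)
  ultimately show ?thesis
    using mult_imp[of "a \<otimes> b" x z] ab x z unfolding a_def b_def by (simp only: m_closed)
qed

lemma F_imp_trans:
  assumes "x \<in> carrier H" "y \<in> carrier H" "z \<in> carrier H" "x \<leadsto> y \<in> F" "y \<leadsto> z \<in> F"
  shows "x \<leadsto> z \<in> F"
  by (rule F_up[OF F_mult[OF assms(4,5)] imp_closed imp_trans_le]) (fact assms)+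

lemma equiv_cong: "equiv (carrier H) (filter_cong H F)"
proof (rule equivI)
  show "filter_cong H F \<subseteq> carrier H \<times> carrier H" by (auto simp: cong_iff)
  show "refl_on (carrier H) (filter_cong H F)"
    by (auto simp: refl_on_def cong_iff F_one)
  show "sym (filter_cong H F)" by (auto simp: sym_def cong_iff)
  show "trans (filter_cong H F)"
    unfolding trans_def cong_iff by (blast intro: F_imp_trans)
qed

lemma cong_trans:
  "\<lbrakk>(x, y) \<in> filter_cong H F; (y, z) \<in> filter_cong H F\<rbrakk> \<Longrightarrow> (x, z) \<in> filter_cong H F"
  using equiv_cong by (meson equivE transD)

lemma F_imp_mult:
  assumes "x \<in> carrier H" "y \<in> carrier H" "z \<in> carrier H" "x \<leadsto> y \<in> F"
  shows "(x \<otimes> z) \<leadsto> (y \<otimes> z) \<in> F"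
proof -
  have "((x \<otimes> (x \<leadsto> y)) \<otimes> z) \<leadsto> (y \<otimes> z) = \<one>"
    using assms by (intro mult_mono imp_mult_le imp_closed m_closed)
  then have "(x \<leadsto> y) \<leadsto> ((x \<otimes> z) \<leadsto> (y \<otimes> z)) = \<one>"
    using mult_imp[of "x \<leadsto> y" "x \<otimes> z" "y \<otimes> z"] assms by (simp add: m_ac)
  then show ?thesis using F_up[OF assms(4)] assms by simp
qed

lemma cong_mult:
  assumes "(x, x') \<in> filter_cong H F" "(y, y') \<in> filter_cong H F"
  shows "(x \<otimes> y, x' \<otimes> y') \<in> filter_cong H F"
proof -
  have "(x \<otimes> y, x' \<otimes> y) \<in> filter_cong H F"
    using assms by (simp add: cong_iff F_imp_mult)
  moreover have "(y \<otimes> x', y' \<otimes> x') \<in> filter_cong H F"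
    using assms by (simp add: cong_iff F_imp_mult)
  moreover have "x' \<otimes> y = y \<otimes> x'" "y' \<otimes> x' = x' \<otimes> y'"
    using assms by (auto simp: cong_iff m_comm)
  ultimately show ?thesis
    by (metis cong_trans)
qed

lemma cong_imp:
  assumes "(x, x') \<in> filter_cong H F" "(y, y') \<in> filter_cong H F"
  shows "(x \<leadsto> y, x' \<leadsto> y') \<in> filter_cong H F"
proof -
  have 1: "(x \<leadsto> y) \<leadsto> (x \<leadsto> z) \<in> F"
    if "x \<in> carrier H" "y \<in> carrier H" "z \<in> carrier H" "y \<leadsto> z \<in> F" for x y z
  proof -
    have "(y \<leadsto> z) \<leadsto> ((x \<leadsto> y) \<leadsto> (x \<leadsto> z)) = \<one>"
      using imp_trans_le[of x y z] mult_imp[of "y \<leadsto> z" "x \<leadsto> y" "x \<leadsto> z"] that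
      by (simp add: m_comm)
    then show ?thesis using F_up[OF that(4)] that by simp
  qed
  have 2: "(y \<leadsto> z) \<leadsto> (x \<leadsto> z) \<in> F"
    if "x \<in> carrier H" "y \<in> carrier H" "z \<in> carrier H" "x \<leadsto> y \<in> F" for x y z
  proof -
    have "(x \<leadsto> y) \<leadsto> ((y \<leadsto> z) \<leadsto> (x \<leadsto> z)) = \<one>"
      using imp_trans_le[of x y z] mult_imp[of "x \<leadsto> y" "y \<leadsto> z" "x \<leadsto> z"] that by simp
    then show ?thesis using F_up[OF that(4)] that by simp
  qed
  have "(x \<leadsto> y, x \<leadsto> y') \<in> filter_cong H F"
    using assms by (simp add: cong_iff 1)
  moreover have "(x \<leadsto> y', x' \<leadsto> y') \<in> filter_cong H F"
    using assms by (simp add: cong_iff 2)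
  ultimately show ?thesis
    by (metis cong_trans)
qed

lemma quotient_mult:
  assumes "x \<in> carrier H" "y \<in> carrier H"
  shows "filter_cong H F `` {x} \<otimes>\<^bsub>hoop_quotient H F\<^esub> filter_cong H F `` {y}
    = filter_cong H F `` {x \<otimes> y}"
proof -
  have "congruent2 (filter_cong H F) (filter_cong H F) (\<lambda>x y. filter_cong H F `` {x \<otimes> y})"
    using equiv_class_eq[OF equiv_cong] cong_mult by (fastforce simp: congruent2_def)
  from UN_equiv_class2[OF equiv_cong equiv_cong this assms]
  show ?thesis by (simp add: hoop_quotient_def)
qed

lemma quotient_imp:
  assumes "x \<in> carrier H" "y \<in> carrier H"
  shows "filter_cong H F `` {x} \<leadsto>\<^bsub>hoop_quotient H F\<^esub> filter_cong H F `` {y}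
    = filter_cong H F `` {x \<leadsto> y}"
proof -
  have "congruent2 (filter_cong H F) (filter_cong H F) (\<lambda>x y. filter_cong H F `` {x \<leadsto> y})"
    using equiv_class_eq[OF equiv_cong] cong_imp by (fastforce simp: congruent2_def)
  from UN_equiv_class2[OF equiv_cong equiv_cong this assms]
  show ?thesis by (simp add: hoop_quotient_def)
qed

lemma class_top_greatest:
  assumes l: "least (hoop_order H) l F" and X: "X \<in> carrier (hoop_quotient H F)"
  shows "greatest (hoop_order H) (class_top H X) X"
proof -
  from X obtain x where x: "x \<in> carrier H" "X = filter_cong H F `` {x}"
    unfolding hoop_quotient_def by (auto elim!: quotientE)
  have lF: "l \<in> F" and lc: "l \<in> carrier H" and l_le: "\<And>u. u \<in> F \<Longrightarrow> l \<leadsto> u = \<one>"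
    using l by (auto simp: least_def)
  have "x \<leadsto> (l \<leadsto> x) = \<one>"
    unfolding mult_imp[OF x(1) lc x(1), symmetric] using x(1) lc by (rule mult_le)
  then have 1: "x \<leadsto> (l \<leadsto> x) \<in> F" using F_one by (rule ssubst)
  have "l \<leadsto> ((l \<leadsto> x) \<leadsto> x) = \<one>"
    unfolding mult_imp[OF lc imp_closed[OF lc x(1)] x(1), symmetric]
    using lc x(1) by (rule imp_mult_le)
  then have "(l \<leadsto> x) \<leadsto> x \<in> F" by (intro F_up[OF lF] imp_closed lc x)
  with 1 have mem: "l \<leadsto> x \<in> X" unfolding x(2) using x(1) lc by (simp add: cong_iff)
  have ub: "y \<leadsto> (l \<leadsto> x) = \<one>" if "y \<in> X" for y
  proof -
    have y: "y \<in> carrier H" "l \<leadsto> (y \<leadsto> x) = \<one>"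
      using that unfolding x(2) by (simp_all add: cong_iff l_le)
    have "y \<leadsto> (l \<leadsto> x) = (l \<otimes> y) \<leadsto> x"
      unfolding m_comm[OF lc y(1)] mult_imp[OF y(1) lc x(1)] ..
    then show ?thesis unfolding mult_imp[OF lc y(1) x(1)] y(2) .
  qed
  have sub: "X \<subseteq> carrier H" unfolding x(2) by (auto simp: cong_iff)
  show ?thesis unfolding class_top_def
  proof (rule theI)
    show "greatest (hoop_order H) (l \<leadsto> x) X"
      using mem ub sub by (simp add: greatest_def)
    fix t assume "greatest (hoop_order H) t X"
    then have "t \<in> X" "(l \<leadsto> x) \<leadsto> t = \<one>" using mem by (simp_all add: greatest_def)
    then show "t = l \<leadsto> x"
      using le_antisymm[of t "l \<leadsto> x"] mem ub sub by blast
  qed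
qed

end

end

theory Submission
  imports Defs
begin

text \<open>Since \<open>l\<close> is idempotent, \<open>l \<and> x = l \<cdot> x\<close>, and the greatest element of the class of \<open>x\<close> is
  \<open>s = l \<rightarrow> x\<close>, which satisfies \<open>l \<rightarrow> s = s\<close>. Put \<open>u = s \<or> l\<close>. Then \<open>u \<rightarrow> s = s\<close>, hence
  \<open>s = u \<and> s = u \<cdot> (u \<rightarrow> s) = u \<cdot> s \<le> u\<^sup>2\<close>, and so \<open>u\<close> is idempotent. Products of idempotents are
  infima, which makes \<open>\<psi>\<close> a product morphism. The isomorphism is \<open>x \<mapsto> (x \<or> l, [x])\<close>, with inverse
  \<open>(a, X) \<mapsto> a \<and> t\<^sub>X\<close>: the class of \<open>x\<close> determines \<open>x \<and> l\<close>, and the lattice is distributive because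
  multiplication, being residuated, preserves suprema.\<close>

section \<open>Residuation, idempotents and infima in an arbitrary hoop\<close>

context hoop
begin

abbreviation le_hoop (infix "\<preceq>" 50) where "x \<preceq> y \<equiv> x \<leadsto> y = \<one>"
abbreviation sup_hoop (infixl "\<or>\<^sub>h" 65) where "x \<or>\<^sub>h y \<equiv> x \<squnion>\<^bsub>hoop_order H\<^esub> y"
abbreviation inf_hoop (infixl "\<and>\<^sub>h" 70) where "x \<and>\<^sub>h y \<equiv> hoop_inf H x y"

lemma le_inf_iff:
  assumes "x \<in> carrier H" "y \<in> carrier H" "z \<in> carrier H"
  shows "z \<preceq> x \<and>\<^sub>h y \<longleftrightarrow> z \<preceq> x \<and> z \<preceq> y"
  using assms le_hoop_inf hoop_inf_le le_transitive by metis

lemma inf_commute: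
  "\<lbrakk>x \<in> carrier H; y \<in> carrier H\<rbrakk> \<Longrightarrow> x \<and>\<^sub>h y = y \<and>\<^sub>h x"
  by (simp add: hoop_inf_def mult_imp_swap)

lemma inf_absorb:
  "\<lbrakk>x \<in> carrier H; y \<in> carrier H; x \<preceq> y\<rbrakk> \<Longrightarrow> x \<and>\<^sub>h y = x"
  by (simp add: hoop_inf_def)

text \<open>Residuation, which is \<open>mult_imp\<close> read at the value \<open>\<one>\<close>.
  This adjunction drives the monotonicity and preservation facts that follow.\<close>

lemma le_imp_iff:
  "\<lbrakk>x \<in> carrier H; y \<in> carrier H; z \<in> carrier H\<rbrakk> \<Longrightarrow> x \<preceq> y \<leadsto> z \<longleftrightarrow> x \<otimes> y \<preceq> z"
  by (simp add: mult_imp)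

lemma le_imp:
  "\<lbrakk>x \<in> carrier H; y \<in> carrier H\<rbrakk> \<Longrightarrow> x \<preceq> y \<leadsto> x"
  by (simp add: le_imp_iff mult_le)

lemma mult_mono2:
  assumes "x \<in> carrier H" "y \<in> carrier H" "x' \<in> carrier H" "y' \<in> carrier H" "x \<preceq> x'" "y \<preceq> y'"
  shows "x \<otimes> y \<preceq> x' \<otimes> y'"
proof -
  have "x \<otimes> y \<preceq> x' \<otimes> y" using assms by (simp add: mult_mono)
  moreover have "x' \<otimes> y \<preceq> x' \<otimes> y'"
    using assms mult_mono[of y y' x'] by (simp add: m_comm)
  ultimately show ?thesis using assms by (meson le_transitive m_closed)
qed

lemma mult_le_inf:
  "\<lbrakk>x \<in> carrier H; y \<in> carrier H\<rbrakk> \<Longrightarrow> x \<otimes> y \<preceq> x \<and>\<^sub>h y"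
  by (simp add: le_inf_iff mult_le)

text \<open>For idempotent \<open>x\<close> the factor \<open>x\<close> in
  \<open>x \<otimes> (x \<leadsto> y)\<close> can be doubled, so the infimum equals \<open>x\<close>
  times itself and hence lies below \<open>x \<otimes> y\<close>.\<close>

lemma inf_idem_eq_mult:
  assumes "x \<in> carrier H" "y \<in> carrier H" "x \<otimes> x = x"
  shows "x \<and>\<^sub>h y = x \<otimes> y"
proof (rule le_antisymm)
  have "x \<and>\<^sub>h y = x \<otimes> (x \<and>\<^sub>h y)"
    using assms m_assoc[of x x "x \<leadsto> y"] by (simp add: hoop_inf_def)
  moreover have "x \<otimes> (x \<and>\<^sub>h y) \<preceq> x \<otimes> y"
    using assms by (intro mult_mono2) (simp_all add: hoop_inf_le)
  ultimately show "x \<and>\<^sub>h y \<preceq> x \<otimes> y" by simp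
qed (use assms in \<open>simp_all add: mult_le_inf hoop_inf_le\<close>)

lemma imp_antimono:
  assumes "x \<in> carrier H" "y \<in> carrier H" "z \<in> carrier H" "x \<preceq> y"
  shows "y \<leadsto> z \<preceq> x \<leadsto> z"
proof -
  have "(y \<leadsto> z) \<otimes> x \<preceq> (y \<leadsto> z) \<otimes> y" using assms by (intro mult_mono2) simp_all
  moreover have "(y \<leadsto> z) \<otimes> y \<preceq> z" using assms imp_mult_le[of y z] by (simp add: m_comm)
  ultimately show ?thesis using assms by (simp add: le_imp_iff) (meson le_transitive m_closed imp_closed)
qed

lemma imp_mono:
  assumes "x \<in> carrier H" "y \<in> carrier H" "z \<in> carrier H" "x \<preceq> y"
  shows "z \<leadsto> x \<preceq> z \<leadsto> y"
proof -
  have "(z \<leadsto> x) \<otimes> z \<preceq> x" using assms imp_mult_le[of z x] by (simp add: m_comm)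
  then show ?thesis using assms by (simp add: le_imp_iff) (meson le_transitive m_closed imp_closed)
qed

text \<open>A right adjoint preserves infima: both sides have the same lower bounds once
  \<open>z\<close> is moved across by residuation.\<close>

lemma imp_inf:
  assumes "x \<in> carrier H" "y \<in> carrier H" "z \<in> carrier H"
  shows "z \<leadsto> (x \<and>\<^sub>h y) = (z \<leadsto> x) \<and>\<^sub>h (z \<leadsto> y)"
proof (rule le_antisymm)
  let ?w = "(z \<leadsto> x) \<and>\<^sub>h (z \<leadsto> y)"
  have w: "?w \<in> carrier H" using assms by (simp add: hoop_inf_le)
  have "?w \<preceq> z \<leadsto> x" "?w \<preceq> z \<leadsto> y" using assms by (simp_all add: hoop_inf_le)
  then show "?w \<preceq> z \<leadsto> (x \<and>\<^sub>h y)"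
    using w assms le_imp_iff[of ?w z x] le_imp_iff[of ?w z y] le_imp_iff[of ?w z "x \<and>\<^sub>h y"]
    by (simp add: le_inf_iff hoop_inf_le)
qed (use assms in \<open>simp_all add: le_inf_iff hoop_inf_le imp_mono\<close>)

end

section \<open>Suprema in a finite hoop and distributivity\<close>

locale finite_hoop = hoop +
  assumes finite_carrier: "finite (carrier H)"
begin

lemma sup_closed [simp]:
  "\<lbrakk>x \<in> carrier H; y \<in> carrier H\<rbrakk> \<Longrightarrow> x \<or>\<^sub>h y \<in> carrier H"
  and sup_ge1: "\<lbrakk>x \<in> carrier H; y \<in> carrier H\<rbrakk> \<Longrightarrow> x \<preceq> x \<or>\<^sub>h y"
  and sup_ge2: "\<lbrakk>x \<in> carrier H; y \<in> carrier H\<rbrakk> \<Longrightarrow> y \<preceq> x \<or>\<^sub>h y"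
  and sup_lub: "\<lbrakk>x \<in> carrier H; y \<in> carrier H; z \<in> carrier H; x \<preceq> z; y \<preceq> z\<rbrakk> \<Longrightarrow> x \<or>\<^sub>h y \<preceq> z"
  using join_least[OF finite_carrier, of x y] by (auto simp: least_def Upper_def)

lemma sup_le_iff:
  assumes "x \<in> carrier H" "y \<in> carrier H" "z \<in> carrier H"
  shows "x \<or>\<^sub>h y \<preceq> z \<longleftrightarrow> x \<preceq> z \<and> y \<preceq> z"
  using assms sup_lub sup_ge1 sup_ge2 le_transitive sup_closed by metis

lemma sup_mono:
  assumes "x \<in> carrier H" "y \<in> carrier H" "z \<in> carrier H" "x \<preceq> y"
  shows "x \<or>\<^sub>h z \<preceq> y \<or>\<^sub>h z"
  using assms le_transitive[of x y "y \<or>\<^sub>h z"] by (simp add: sup_le_iff sup_ge1 sup_ge2)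

lemma sup_absorb:
  "\<lbrakk>x \<in> carrier H; y \<in> carrier H; y \<preceq> x\<rbrakk> \<Longrightarrow> x \<or>\<^sub>h y = x"
  by (rule le_antisymm) (simp_all add: sup_le_iff sup_ge1)

text \<open>A left adjoint preserves suprema: the bound on \<open>x \<or>\<^sub>h y\<close> is
  checked after moving \<open>z\<close> to the right by residuation.\<close>

lemma sup_mult:
  assumes "x \<in> carrier H" "y \<in> carrier H" "z \<in> carrier H"
  shows "(x \<or>\<^sub>h y) \<otimes> z = (x \<otimes> z) \<or>\<^sub>h (y \<otimes> z)"
proof (rule le_antisymm)
  have "x \<or>\<^sub>h y \<preceq> z \<leadsto> ((x \<otimes> z) \<or>\<^sub>h (y \<otimes> z))"
    using assms by (intro sup_lub) (simp_all add: le_imp_iff sup_ge1 sup_ge2)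
  then show "(x \<or>\<^sub>h y) \<otimes> z \<preceq> (x \<otimes> z) \<or>\<^sub>h (y \<otimes> z)"
    by (rule le_imp_iff[THEN iffD1, rotated -1]) (use assms in simp_all)
qed (use assms in \<open>simp_all add: sup_le_iff mult_mono sup_ge1 sup_ge2\<close>)

text \<open>The infimum is a product, \<open>(x \<or>\<^sub>h y) \<otimes> r\<close> with
  \<open>r = (x \<or>\<^sub>h y) \<leadsto> z\<close>, and the product distributes over the
  supremum. As implication is antitone on the left, \<open>r\<close> is below
  \<open>x \<leadsto> z\<close> and \<open>y \<leadsto> z\<close>, so the two summands are below the
  two infima.\<close>

lemma sup_inf:
  assumes "x \<in> carrier H" "y \<in> carrier H" "z \<in> carrier H"
  shows "(x \<or>\<^sub>h y) \<and>\<^sub>h z = (x \<and>\<^sub>h z) \<or>\<^sub>h (y \<and>\<^sub>h z)"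
proof (rule le_antisymm)
  let ?r = "(x \<or>\<^sub>h y) \<leadsto> z"
  have r: "?r \<in> carrier H" "?r \<preceq> x \<leadsto> z" "?r \<preceq> y \<leadsto> z"
    using assms by (simp_all add: imp_antimono sup_ge1 sup_ge2)
  have "x \<otimes> ?r \<preceq> x \<and>\<^sub>h z" "y \<otimes> ?r \<preceq> y \<and>\<^sub>h z"
    unfolding hoop_inf_def using r assms by (auto intro!: mult_mono2)
  then have "x \<otimes> ?r \<preceq> (x \<and>\<^sub>h z) \<or>\<^sub>h (y \<and>\<^sub>h z)" "y \<otimes> ?r \<preceq> (x \<and>\<^sub>h z) \<or>\<^sub>h (y \<and>\<^sub>h z)"
    using assms r by (meson le_transitive sup_ge1 sup_ge2 sup_closed m_closed hoop_inf_le(1))+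
  then show "(x \<or>\<^sub>h y) \<and>\<^sub>h z \<preceq> (x \<and>\<^sub>h z) \<or>\<^sub>h (y \<and>\<^sub>h z)"
    using assms r unfolding hoop_inf_def[of H "x \<or>\<^sub>h y"]
    by (simp add: sup_mult sup_le_iff hoop_inf_le)
  show "(x \<and>\<^sub>h z) \<or>\<^sub>h (y \<and>\<^sub>h z) \<preceq> (x \<or>\<^sub>h y) \<and>\<^sub>h z"
    using assms by (simp add: sup_le_iff le_inf_iff hoop_inf_le)
      (meson le_transitive sup_ge1 sup_ge2 sup_closed hoop_inf_le)
qed (use assms in \<open>simp_all add: hoop_inf_le\<close>)

lemma inf_sup:
  assumes "x \<in> carrier H" "y \<in> carrier H" "z \<in> carrier H"
  shows "z \<and>\<^sub>h (x \<or>\<^sub>h y) = (z \<and>\<^sub>h x) \<or>\<^sub>h (z \<and>\<^sub>h y)"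
  using sup_inf[OF assms] assms by (simp add: inf_commute)

text \<open>The dual law, from two expansions by the first one: apart from
  \<open>x \<and>\<^sub>h y\<close>, every term that arises is below \<open>z\<close>.\<close>

lemma sup_inf_distrib:
  assumes "x \<in> carrier H" "y \<in> carrier H" "z \<in> carrier H"
  shows "(x \<and>\<^sub>h y) \<or>\<^sub>h z = (x \<or>\<^sub>h z) \<and>\<^sub>h (y \<or>\<^sub>h z)"
proof (rule le_antisymm)
  have le: "x \<and>\<^sub>h z \<preceq> z" "z \<and>\<^sub>h (y \<or>\<^sub>h z) \<preceq> z" using assms by (simp_all add: hoop_inf_le)
  have "x \<and>\<^sub>h (y \<or>\<^sub>h z) \<preceq> (x \<and>\<^sub>h y) \<or>\<^sub>h z"
    using assms le by (simp add: inf_sup sup_le_iff hoop_inf_le sup_ge1)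
      (meson le_transitive sup_ge2 sup_closed hoop_inf_le)
  moreover have "z \<and>\<^sub>h (y \<or>\<^sub>h z) \<preceq> (x \<and>\<^sub>h y) \<or>\<^sub>h z"
    using assms le by (meson le_transitive sup_ge2 sup_closed hoop_inf_le)
  ultimately show "(x \<or>\<^sub>h z) \<and>\<^sub>h (y \<or>\<^sub>h z) \<preceq> (x \<and>\<^sub>h y) \<or>\<^sub>h z"
    using assms by (simp add: sup_inf[of x z] sup_le_iff hoop_inf_le)
  show "(x \<and>\<^sub>h y) \<or>\<^sub>h z \<preceq> (x \<or>\<^sub>h z) \<and>\<^sub>h (y \<or>\<^sub>h z)"
    using assms by (simp add: sup_mono hoop_inf_le le_inf_iff)
qed (use assms in \<open>simp_all add: hoop_inf_le\<close>)

text \<open>Makes joining with \<open>l\<close> multiplicative. In the expanded product every term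
  except \<open>x \<otimes> y\<close> has a factor \<open>z\<close> and so is below
  \<open>z\<close>; conversely \<open>z = z \<otimes> z\<close> is below the product.\<close>

lemma sup_mult_sup:
  assumes "x \<in> carrier H" "y \<in> carrier H" "z \<in> carrier H" "z \<otimes> z = z"
  shows "(x \<or>\<^sub>h z) \<otimes> (y \<or>\<^sub>h z) = (x \<otimes> y) \<or>\<^sub>h z"
proof (rule le_antisymm)
  have "x \<otimes> y \<preceq> (x \<or>\<^sub>h z) \<otimes> (y \<or>\<^sub>h z)" "z \<otimes> z \<preceq> (x \<or>\<^sub>h z) \<otimes> (y \<or>\<^sub>h z)"
    using assms(1-3) by (auto intro!: mult_mono2 sup_ge1 sup_ge2)
  then show "(x \<otimes> y) \<or>\<^sub>h z \<preceq> (x \<or>\<^sub>h z) \<otimes> (y \<or>\<^sub>h z)" using assms by (simp add: sup_le_iff)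
  have le: "a \<preceq> (x \<otimes> y) \<or>\<^sub>h z" if "a \<in> carrier H" "a \<preceq> z" for a
    using that assms by (meson le_transitive sup_ge2 sup_closed m_closed)
  have "(y \<or>\<^sub>h z) \<otimes> x \<preceq> (x \<otimes> y) \<or>\<^sub>h z"
    using assms(1-3) by (simp add: sup_mult sup_le_iff le mult_le m_comm[of y x] sup_ge1)
  moreover have "z \<otimes> (y \<or>\<^sub>h z) \<preceq> (x \<otimes> y) \<or>\<^sub>h z"
    using assms(1-3) by (simp add: le mult_le)
  ultimately show "(x \<or>\<^sub>h z) \<otimes> (y \<or>\<^sub>h z) \<preceq> (x \<otimes> y) \<or>\<^sub>h z"
    using assms(1-3) by (simp add: sup_mult[of x z] sup_le_iff m_comm[of x "y \<or>\<^sub>h z"])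
qed (use assms(1-3) in simp_all)

end

section \<open>The quotient and the filter as hoops\<close>

context hoop_with_filter
begin

abbreviation cls where "cls x \<equiv> filter_cong H F `` {x}"
abbreviation Q where "Q \<equiv> hoop_quotient H F"

lemma carrier_quotient: "carrier Q = cls ` carrier H"
  by (auto simp: hoop_quotient_def quotient_def)

lemma one_quotient: "\<one>\<^bsub>Q\<^esub> = cls \<one>"
  by (simp add: hoop_quotient_def)

lemma quotient_inf:
  "\<lbrakk>x \<in> carrier H; y \<in> carrier H\<rbrakk> \<Longrightarrow> hoop_inf Q (cls x) (cls y) = cls (x \<and>\<^sub>h y)"
  by (simp add: hoop_inf_def quotient_mult quotient_imp)

lemma cls_eq_iff:
  "\<lbrakk>x \<in> carrier H; y \<in> carrier H\<rbrakk> \<Longrightarrow> cls x = cls y \<longleftrightarrow> x \<leadsto> y \<in> F \<and> y \<leadsto> x \<in> F"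
  using eq_equiv_class_iff[OF equiv_cong] by (simp add: cong_iff)

lemma hoop_quotient: "hoop Q"
proof unfold_locales
  fix X Y assume "X \<in> carrier Q" "Y \<in> carrier Q"
  then obtain x y where xy: "x \<in> carrier H" "X = cls x" "y \<in> carrier H" "Y = cls y"
    by (auto simp: carrier_quotient)
  then show "X \<otimes>\<^bsub>Q\<^esub> Y \<in> carrier Q" "X \<leadsto>\<^bsub>Q\<^esub> Y \<in> carrier Q"
    "X \<otimes>\<^bsub>Q\<^esub> Y = Y \<otimes>\<^bsub>Q\<^esub> X" "X \<otimes>\<^bsub>Q\<^esub> (X \<leadsto>\<^bsub>Q\<^esub> Y) = Y \<otimes>\<^bsub>Q\<^esub> (Y \<leadsto>\<^bsub>Q\<^esub> X)"
    by (simp_all add: carrier_quotient quotient_mult quotient_imp m_comm[of x y] mult_imp_swap[of x y])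
next
  fix X Y Z assume "X \<in> carrier Q" "Y \<in> carrier Q" "Z \<in> carrier Q"
  then obtain x y z where xyz: "x \<in> carrier H" "X = cls x" "y \<in> carrier H" "Y = cls y"
      "z \<in> carrier H" "Z = cls z"
    by (auto simp: carrier_quotient)
  then show "X \<otimes>\<^bsub>Q\<^esub> Y \<otimes>\<^bsub>Q\<^esub> Z = X \<otimes>\<^bsub>Q\<^esub> (Y \<otimes>\<^bsub>Q\<^esub> Z)"
    "(X \<otimes>\<^bsub>Q\<^esub> Y) \<leadsto>\<^bsub>Q\<^esub> Z = X \<leadsto>\<^bsub>Q\<^esub> (Y \<leadsto>\<^bsub>Q\<^esub> Z)"
    by (simp_all add: quotient_mult quotient_imp m_assoc mult_imp)
qed (auto simp: carrier_quotient one_quotient quotient_mult quotient_imp)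

lemma subhoop_simps [simp]:
  "carrier (subhoop H F) = F" "mult (subhoop H F) = mult H" "imp (subhoop H F) = imp H"
  "one (subhoop H F) = \<one>" "hoop_inf (subhoop H F) = hoop_inf H"
  by (auto simp: subhoop_def hoop_inf_def fun_eq_iff)

lemma F_imp: "\<lbrakk>x \<in> F; y \<in> F\<rbrakk> \<Longrightarrow> x \<leadsto> y \<in> F"
  using F_up[of y "x \<leadsto> y"] by (simp add: le_imp F_sub)

lemma hoop_subhoop: "hoop (subhoop H F)"
proof unfold_locales
  fix x y assume "x \<in> carrier (subhoop H F)" "y \<in> carrier (subhoop H F)"
  then show "x \<otimes>\<^bsub>subhoop H F\<^esub> (x \<leadsto>\<^bsub>subhoop H F\<^esub> y) = y \<otimes>\<^bsub>subhoop H F\<^esub> (y \<leadsto>\<^bsub>subhoop H F\<^esub> x)"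
    by (simp add: F_sub mult_imp_swap[of x y])
qed (simp_all add: F_mult F_one F_imp F_sub m_ac mult_imp)

end

section \<open>The least element of the filter and the greatest elements of the classes\<close>

locale finite_hoop_with_filter = finite_hoop + hoop_with_filter +
  fixes l
  assumes l_least: "least (hoop_order H) l F"
begin

lemma l_F: "l \<in> F" and l_le: "x \<in> F \<Longrightarrow> l \<preceq> x"
  using l_least by (auto simp: least_def)

lemma l_closed [simp]: "l \<in> carrier H"
  using l_F F_sub by blast

text \<open>\<open>l \<otimes> l\<close> lies in \<open>F\<close>, so it cannot be strictly below
  the least element.\<close>

lemma l_idem [simp]: "l \<otimes> l = l"
  by (rule le_antisymm) (simp_all add: l_le F_mult l_F mult_le)

text \<open>With residuation this turns \<open>x \<leadsto> y \<in> F\<close> into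
  \<open>l \<otimes> x \<preceq> y\<close>, so that congruence becomes a pair of
  inequalities.\<close>

lemma F_iff: "x \<in> F \<longleftrightarrow> x \<in> carrier H \<and> l \<preceq> x"
  using l_F l_le F_up F_sub by blast

lemma sup_l_F: "x \<in> carrier H \<Longrightarrow> x \<or>\<^sub>h l \<in> F"
  by (simp add: F_iff sup_ge2)

lemma inf_l_eq_if_cls_eq:
  assumes "x \<in> carrier H" "y \<in> carrier H" "cls x = cls y"
  shows "x \<and>\<^sub>h l = y \<and>\<^sub>h l"
proof -
  have "l \<otimes> x \<preceq> y" "l \<otimes> y \<preceq> x" using assms by (simp_all add: cls_eq_iff F_iff le_imp_iff)
  then have "l \<and>\<^sub>h x \<preceq> y" "l \<and>\<^sub>h y \<preceq> x" using assms by (simp_all add: inf_idem_eq_mult)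
  then have "l \<and>\<^sub>h x \<preceq> l \<and>\<^sub>h y" "l \<and>\<^sub>h y \<preceq> l \<and>\<^sub>h x"
    using assms(1,2) by (simp_all add: le_inf_iff hoop_inf_le)
  then show ?thesis
    using assms(1,2) le_antisymm[of "l \<and>\<^sub>h x" "l \<and>\<^sub>h y"] by (simp add: hoop_inf_le inf_commute[of _ l])
qed

text \<open>\<open>x\<close> is below \<open>l \<leadsto> x\<close>, and
  \<open>l \<otimes> (l \<leadsto> x) \<preceq> x\<close> puts the reverse implication above
  \<open>l\<close>.\<close>

lemma cls_imp_l: "x \<in> carrier H \<Longrightarrow> cls (l \<leadsto> x) = cls x"
  using imp_mult_le[of l x]
  by (simp add: cls_eq_iff F_iff le_imp le_imp_iff mult_le flip: mult_imp)

text \<open>A member \<open>t\<close> of the class satisfies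
  \<open>l \<preceq> t \<leadsto> x\<close>, which by residuation says
  \<open>t \<preceq> l \<leadsto> x\<close>; and \<open>l \<leadsto> x\<close> is itself in the
  class.\<close>

lemma class_top_eq:
  assumes x: "x \<in> carrier H"
  shows "class_top H (cls x) = l \<leadsto> x"
proof -
  define t where "t = class_top H (cls x)"
  have "greatest (hoop_order H) t (cls x)"
    unfolding t_def using x by (intro class_top_greatest[OF l_least]) (simp add: carrier_quotient)
  then have t: "t \<in> cls x" "\<And>y. y \<in> cls x \<Longrightarrow> y \<preceq> t" by (auto simp: greatest_def)
  have tc: "t \<in> carrier H" "l \<preceq> t \<leadsto> x" using t(1) by (auto simp: cong_iff F_iff)
  have "l \<leadsto> x \<in> cls x"
    using cls_imp_l[OF x] x equiv_class_self[OF equiv_cong, of "l \<leadsto> x"] by simp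
  moreover have "t \<preceq> l \<leadsto> x" using tc x by (simp add: le_imp_iff m_comm)
  ultimately show ?thesis
    unfolding t_def[symmetric] using t(2) tc x le_antisymm[of t "l \<leadsto> x"] by simp
qed

section \<open>The map \<open>psi\<close>: product morphism and relation to implication\<close>

abbreviation psi where "psi \<equiv> class_top_join H l"

lemma psi_cls: "x \<in> carrier H \<Longrightarrow> psi (cls x) = (l \<leadsto> x) \<or>\<^sub>h l"
  by (simp add: class_top_join_def class_top_eq)

lemma psi_F: "x \<in> carrier H \<Longrightarrow> psi (cls x) \<in> F"
  by (simp add: psi_cls sup_l_F)

lemma psi_idem:
  assumes x: "x \<in> carrier H"
  shows "psi (cls x) \<otimes> psi (cls x) = psi (cls x)"
proof -
  define s where "s = l \<leadsto> x"
  define u where "u = s \<or>\<^sub>h l"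
  have c: "s \<in> carrier H" "u \<in> carrier H" using x by (simp_all add: s_def u_def)
  \<comment> \<open>Idempotence of \<open>l\<close> enters here:
    \<open>l \<leadsto> (l \<leadsto> x) = (l \<otimes> l) \<leadsto> x\<close>.\<close>
  have ls: "l \<leadsto> s = s" using x by (simp add: s_def flip: mult_imp)
  have us: "u \<leadsto> s \<preceq> s" using imp_antimono[of l u s] c ls by (simp add: u_def sup_ge2)
  have "u \<leadsto> s = s" by (rule le_antisymm) (use c us in \<open>simp_all add: le_imp\<close>)
  moreover have "u \<and>\<^sub>h s = s" using c by (simp add: inf_commute inf_absorb u_def sup_ge1)
  ultimately have "s = u \<otimes> s" by (simp add: hoop_inf_def)
  also have "\<dots> \<preceq> u \<otimes> u" using c by (intro mult_mono2) (simp_all add: u_def sup_ge1)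
  finally have "s \<preceq> u \<otimes> u" .
  \<comment> \<open>The other joinand of \<open>u\<close>: since \<open>u\<close> is in
    \<open>F\<close>, so is its square, which is therefore above \<open>l\<close>.\<close>
  moreover have "l \<preceq> u \<otimes> u" using c by (intro l_le F_mult) (simp_all add: u_def sup_l_F)
  ultimately have uu: "u \<preceq> u \<otimes> u" using c unfolding u_def by (intro sup_lub) simp_all
  have "u \<otimes> u = u" by (rule le_antisymm) (use c uu in \<open>simp_all add: mult_le\<close>)
  then show ?thesis using x by (simp add: psi_cls u_def s_def)
qed

text \<open>Both stages of \<open>psi\<close> preserve infima: \<open>l \<leadsto> _\<close> as a
  right adjoint, joining with \<open>l\<close> by distributivity.\<close>

lemma psi_inf:
  assumes "x \<in> carrier H" "y \<in> carrier H"
  shows "psi (cls (x \<and>\<^sub>h y)) = psi (cls x) \<and>\<^sub>h psi (cls y)"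
  using assms by (simp add: psi_cls hoop_inf_le imp_inf sup_inf_distrib)

lemma psi_mult_psi:
  assumes "x \<in> carrier H" "y \<in> carrier H"
  shows "psi (cls x) \<otimes> psi (cls y) = psi (cls x) \<and>\<^sub>h psi (cls y)"
  using assms by (simp add: inf_idem_eq_mult psi_idem psi_F F_sub)

lemma psi_mult:
  assumes xy: "x \<in> carrier H" "y \<in> carrier H"
  shows "psi (cls (x \<otimes> y)) = psi (cls x) \<otimes> psi (cls y)"
proof (rule le_antisymm)
  have "l \<leadsto> (x \<otimes> y) \<preceq> l \<leadsto> (x \<and>\<^sub>h y)" using xy by (simp add: imp_mono mult_le_inf hoop_inf_le)
  then have "psi (cls (x \<otimes> y)) \<preceq> psi (cls (x \<and>\<^sub>h y))"
    using xy by (simp add: psi_cls sup_mono hoop_inf_le)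
  then show "psi (cls (x \<otimes> y)) \<preceq> psi (cls x) \<otimes> psi (cls y)"
    using xy by (simp add: psi_inf psi_mult_psi)
  let ?s = "l \<leadsto> x" and ?t = "l \<leadsto> y"
  \<comment> \<open>Writing \<open>l\<close> as \<open>l \<otimes> l\<close> gives each of the two
    implications its own copy of \<open>l\<close> to be evaluated at.\<close>
  have "(?s \<otimes> ?t) \<otimes> l = (?s \<otimes> ?t) \<otimes> (l \<otimes> l)" by simp
  also have "\<dots> = (l \<otimes> ?s) \<otimes> (l \<otimes> ?t)" using xy by (simp only: m_ac l_closed imp_closed m_closed)
  also have "\<dots> \<preceq> x \<otimes> y" using xy by (simp add: mult_mono2 imp_mult_le)
  finally have "?s \<otimes> ?t \<preceq> l \<leadsto> (x \<otimes> y)" using xy by (simp add: le_imp_iff)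
  then show "psi (cls x) \<otimes> psi (cls y) \<preceq> psi (cls (x \<otimes> y))"
    using xy by (simp add: psi_cls sup_mult_sup sup_mono)
qed (use xy in \<open>simp_all add: psi_F F_sub\<close>)

lemma product_morphism_psi: "product_morphism Q (subhoop H F) psi"
  by (auto simp: product_morphism_def hoop_quotient hoop_subhoop carrier_quotient psi_F one_quotient
      quotient_mult quotient_inf psi_mult psi_inf psi_mult_psi)
    \<comment> \<open>Preservation of the unit: \<open>l \<leadsto> \<one>\<close> is
      \<open>\<one>\<close>, which absorbs \<open>l\<close>.\<close>
    (simp add: psi_cls sup_absorb)

text \<open>This is the first coordinate of the implication in the f-product. Joining with
  \<open>l\<close> alone need not preserve implication; the infimum with \<open>psi\<close> is the
  correction.\<close>

lemma imp_sup_l: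
  assumes xy: "x \<in> carrier H" "y \<in> carrier H"
  shows "(x \<leadsto> y) \<or>\<^sub>h l = psi (cls (x \<leadsto> y)) \<and>\<^sub>h ((x \<or>\<^sub>h l) \<leadsto> (y \<or>\<^sub>h l))"
proof (rule le_antisymm)
  let ?p = "l \<leadsto> (x \<leadsto> y)" and ?q = "(x \<or>\<^sub>h l) \<leadsto> (y \<or>\<^sub>h l)"
  have l_q: "l \<preceq> ?q" using xy by (intro l_le F_imp sup_l_F)
  have "(x \<leadsto> y) \<otimes> (x \<or>\<^sub>h l) \<preceq> y \<or>\<^sub>h l"
  proof -
    have "x \<otimes> (x \<leadsto> y) \<preceq> y \<or>\<^sub>h l"
      using xy by (meson imp_mult_le sup_ge1 le_transitive m_closed imp_closed sup_closed l_closed)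
    moreover have "l \<otimes> (x \<leadsto> y) \<preceq> y \<or>\<^sub>h l"
      using xy by (meson mult_le sup_ge2 le_transitive m_closed imp_closed sup_closed l_closed)
    ultimately show ?thesis
      using xy by (simp add: m_comm[of "x \<leadsto> y"] sup_mult sup_le_iff)
  qed
  then have "x \<leadsto> y \<preceq> ?q" using xy by (simp add: le_imp_iff)
  with l_q show "(x \<leadsto> y) \<or>\<^sub>h l \<preceq> psi (cls (x \<leadsto> y)) \<and>\<^sub>h ?q"
    using xy by (simp add: psi_cls le_inf_iff sup_mono sup_le_iff le_imp)
  \<comment> \<open>Since \<open>l \<preceq> ?q\<close>, distributivity makes the right-hand side
    equal to \<open>?w \<or>\<^sub>h l\<close>. It is thus enough to bound \<open>?w\<close> by
    \<open>x \<leadsto> y\<close>.\<close>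
  let ?w = "?p \<and>\<^sub>h ?q"
  have w: "?w \<in> carrier H" "?w \<preceq> ?p" "?w \<preceq> ?q" using xy by (simp_all add: hoop_inf_le)
  have "?w \<otimes> x \<preceq> y"
  proof -
    define v where "v = ?w \<otimes> x"
    have v: "v \<in> carrier H" using w xy by (simp add: v_def)
    have "v \<preceq> ?w \<otimes> (x \<or>\<^sub>h l)" unfolding v_def using w xy by (intro mult_mono2) (simp_all add: sup_ge1)
    moreover have "?w \<otimes> (x \<or>\<^sub>h l) \<preceq> y \<or>\<^sub>h l" using w xy by (simp add: le_imp_iff)
    ultimately have "v \<preceq> y \<or>\<^sub>h l" using v w xy by (meson le_transitive m_closed sup_closed l_closed)
    \<comment> \<open>Distributivity splits \<open>v\<close> into a part below \<open>y\<close> and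
      a part below \<open>l\<close>. The second is \<open>l \<otimes> v\<close>, and it is below
      \<open>y\<close> because \<open>?w \<preceq> ?p\<close>.\<close>
    then have "v = (v \<and>\<^sub>h y) \<or>\<^sub>h (v \<and>\<^sub>h l)" using v xy by (simp add: inf_absorb flip: inf_sup)
    moreover have "l \<and>\<^sub>h v \<preceq> y"
    proof -
      have "(?w \<otimes> l) \<otimes> x \<preceq> y" using w xy by (simp add: le_imp_iff m_assoc flip: mult_imp)
      moreover have "l \<otimes> v = (?w \<otimes> l) \<otimes> x" unfolding v_def using w xy by (simp add: m_ac)
      ultimately show ?thesis using v by (simp add: inf_idem_eq_mult)
    qed
    ultimately have "v \<preceq> y" using v xy
      by (metis inf_commute hoop_inf_le(1,3) sup_lub l_closed)
    then show ?thesis by (simp add: v_def)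
  qed
  then have "?w \<preceq> x \<leadsto> y" using w xy by (simp add: le_imp_iff)
  then have "?w \<or>\<^sub>h l \<preceq> (x \<leadsto> y) \<or>\<^sub>h l" using w xy by (simp add: sup_mono)
  moreover have "?w \<or>\<^sub>h l = psi (cls (x \<leadsto> y)) \<and>\<^sub>h ?q"
    using xy l_q by (simp add: psi_cls sup_inf_distrib sup_absorb)
  ultimately show "psi (cls (x \<leadsto> y)) \<and>\<^sub>h ?q \<preceq> (x \<leadsto> y) \<or>\<^sub>h l" by simp
qed (use xy in \<open>simp_all add: psi_cls hoop_inf_le\<close>)

section \<open>The isomorphism onto the f-product\<close>

abbreviation P where "P \<equiv> f_product (subhoop H F) psi Q"

text \<open>Injectivity up to antisymmetry. Distributivity splits
  \<open>x = x \<and>\<^sub>h (y \<or>\<^sub>h l)\<close>, and the part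
  \<open>x \<and>\<^sub>h l\<close> equals \<open>y \<and>\<^sub>h l\<close> because the classes
  agree.\<close>

lemma le_if_sup_l_eq:
  assumes xy: "x \<in> carrier H" "y \<in> carrier H" and "x \<or>\<^sub>h l = y \<or>\<^sub>h l" "cls x = cls y"
  shows "x \<preceq> y"
proof -
  have "x = x \<and>\<^sub>h (y \<or>\<^sub>h l)" using assms sup_ge1[of x l] by (simp add: inf_absorb)
  also have "\<dots> = (x \<and>\<^sub>h y) \<or>\<^sub>h (y \<and>\<^sub>h l)" using xy inf_l_eq_if_cls_eq[OF xy assms(4)] by (simp add: inf_sup)
  also have "\<dots> \<preceq> y" using xy by (simp add: sup_le_iff hoop_inf_le)
  finally show ?thesis .
qed

lemma f_product_surj:
  assumes x: "x \<in> carrier H" and a: "a \<in> F" "a \<preceq> psi (cls x)"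
  shows "\<exists>z\<in>carrier H. z \<or>\<^sub>h l = a \<and> cls z = cls x"
proof (intro bexI conjI)
  define t where "t = l \<leadsto> x"
  have t: "t \<in> carrier H" "cls t = cls x" using x by (simp_all add: t_def cls_imp_l)
  have ac: "a \<in> carrier H" using a F_sub by blast
  show z: "a \<and>\<^sub>h t \<in> carrier H" using ac t by (simp add: hoop_inf_le)
  \<comment> \<open>By distributivity the left side is the infimum of
    \<open>a \<or>\<^sub>h l = a\<close> and \<open>t \<or>\<^sub>h l = psi (cls x)\<close>, and
    \<open>a\<close> is below the latter.\<close>
  show "(a \<and>\<^sub>h t) \<or>\<^sub>h l = a"
    using ac t x a by (simp add: sup_inf_distrib sup_absorb l_le psi_cls inf_absorb flip: t_def)
  have "(a \<and>\<^sub>h t) \<leadsto> t \<in> F" using ac t by (simp add: hoop_inf_le F_one)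
  \<comment> \<open>This implication is above \<open>a\<close>, which is in \<open>F\<close>,
    because \<open>a \<otimes> t\<close> is below the infimum.\<close>
  moreover have "t \<leadsto> (a \<and>\<^sub>h t) \<in> F"
    using ac t z a(1) by (intro F_up[OF a(1)]) (simp_all add: le_imp_iff mult_le_inf)
  ultimately show "cls (a \<and>\<^sub>h t) = cls x"
    unfolding t(2)[symmetric] using cls_eq_iff[OF z t(1)] by simp
qed

lemma hoop_iso_f_product: "(\<lambda>x. (x \<or>\<^sub>h l, cls x)) \<in> hoop_iso H P" (is "?h \<in> _")
proof -
  have carrier_P: "carrier P = {(a, X). a \<in> F \<and> X \<in> cls ` carrier H \<and> a \<preceq> psi X}"
    by (simp add: f_product_def carrier_quotient)
  \<comment> \<open>The bound required by the f-product comes from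
    \<open>x \<preceq> l \<leadsto> x\<close>, joined with \<open>l\<close>.\<close>
  have h_carrier: "?h x \<in> carrier P" if "x \<in> carrier H" for x
    using that by (simp add: carrier_P sup_l_F psi_cls sup_mono le_imp)
  have "inj_on ?h (carrier H)"
    by (rule inj_onI) (simp add: le_antisymm[OF _ _ le_if_sup_l_eq le_if_sup_l_eq])
  moreover have "?h ` carrier H = carrier P"
  proof (rule subset_antisym)
    show "carrier P \<subseteq> ?h ` carrier H"
      using f_product_surj by (fastforce simp: carrier_P)
  qed (use h_carrier in blast)
  ultimately have "bij_betw ?h (carrier H) (carrier P)" by (simp add: bij_betw_def)
  moreover have "?h \<in> hom H P"
    using h_carrier by (auto simp: hom_def f_product_def quotient_mult sup_mult_sup)
  moreover have "?h \<one> = \<one>\<^bsub>P\<^esub>" by (simp add: f_product_def one_quotient sup_absorb)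
  moreover have "?h (x \<leadsto> y) = ?h x \<leadsto>\<^bsub>P\<^esub> ?h y" if "x \<in> carrier H" "y \<in> carrier H" for x y
    using that by (simp add: f_product_def quotient_imp imp_sup_l)
  ultimately show ?thesis by (simp add: hoop_iso_def iso_def)
qed

end

theorem theorem14:
  fixes A :: "('a, 'm) hoop_scheme" and F :: "'a set" and l :: 'a
  assumes "hoop A" and "finite (carrier A)"
    and "hoop_filter A F" and "least (hoop_order A) l F"
  shows "product_morphism (hoop_quotient A F) (subhoop A F) (class_top_join A l) \<and>
    hoop_isomorphic A (f_product (subhoop A F) (class_top_join A l) (hoop_quotient A F))"
proof -
  interpret A: hoop A by fact
  interpret finite_hoop_with_filter A F l by unfold_locales (fact assms)+
  show ?thesis
    using product_morphism_psi hoop_iso_f_product unfolding hoop_isomorphic_def by blast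
qed

end
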